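(* Let $\alpha=(\alpha_1,\dots,\alpha_m)$ be a generic length vector with $\alpha_m<\sum_{i<m}\alpha_i$. Then the poset $\mathrm{Ad}(\alpha)$ of admissible subsets of $[m-1]^{\pm}$ (ordered by $J\le S$ iff $S\subseteq J$) is isomorphic to the face poset of the moment polytope $\mathrm{P}(\alpha)$.
   Context: A length vector is a tuple of positive reals; generic means $\sum_i\varepsilon_i\alpha_i\ne0$ for all signs. $\mathrm{P}(\alpha)=\prod_{i=1}^{m-1}[-\alpha_i,\alpha_i]\cap\{w\in\mathbb{R}^{m-1}:\sum_{i=1}^{m-1}w_i=\alpha_m\}$. Let $[m-1]^+=\{1,\dots,m-1\}$, $[m-1]^-=\{-1,\dots,-(m-1)\}$, $[m-1]^{\pm}=[m-1]^+\cup[m-1]^-$. For $J\subseteq[m-1]^\pm$ write $J_1=J\cap[m-1]^+$, $J_2=J\cap[m-1]^-$, $-J_2=\{-j:j\in J_2\}$, $\alpha_{J_1}=\sum_{i\in J_1}\alpha_i$, $\alpha_{J_2}=\sum_{j\in-J_2}\alpha_j$. $J$ is admissible if $J_1\cap(-J_2)=\emptyset$ and $|\alpha_m+\alpha_{J_1}-\alpha_{J_2}|<\sum_{k\in[m-1]\setminus(J_1\cup-J_2)}\alpha_k$ (i.e. the reduced length vector $(\alpha_{j_1},\dots,\alpha_{j_k},|\alpha_m+\alpha_{J_1}-\alpha_{J_2}|)$, $\{j_1,\dots,j_k\}=[m-1]\setminus(J_1\cup-J_2)$, defines a nonempty generic chain space). The face corresponding to $J$ is $\{x\in\mathrm{P}(\alpha):x_j=\alpha_j\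 (j\in J_1),\ x_j=-\alpha_j\ (j\in-J_2)\}$. *)

theory Defs
  imports "HOL-Analysis.Analysis"
begin

text \<open>
  A tuple \<open>(\<alpha>\<^sub>1, \<dots>, \<alpha>\<^sub>m)\<close> is a function \<open>\<alpha> :: nat \<Rightarrow> real\<close> together with \<open>m\<close>; only the values
  at \<open>1, \<dots>, m\<close> matter.  The index set \<open>[m-1]\<close> is \<open>{1..<m}\<close>.
\<close>

definition length_vector :: "nat \<Rightarrow> (nat \<Rightarrow> real) \<Rightarrow> bool" where
  "length_vector m \<alpha> \<longleftrightarrow> (\<forall>i\<in>{1..m}. \<alpha> i > 0)"

definition generic :: "nat \<Rightarrow> (nat \<Rightarrow> real) \<Rightarrow> bool" where
  "generic m \<alpha> \<longleftrightarrow>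
     (\<forall>\<epsilon> :: nat \<Rightarrow> real. (\<forall>i\<in>{1..m}. \<epsilon> i \<in> {-1, 1}) \<longrightarrow> (\<Sum>i=1..m. \<epsilon> i * \<alpha> i) \<noteq> 0)"

definition signed_indices :: "nat \<Rightarrow> int set" where
  "signed_indices m = int ` {1..<m} \<union> (\<lambda>i. - int i) ` {1..<m}"

text \<open>For \<open>J \<subseteq> [m-1]\<^sup>\<plusminus>\<close>, these are \<open>J\<^sub>1 = J \<inter> [m-1]\<^sup>+\<close> and \<open>-J\<^sub>2 = {-j | j \<in> J \<inter> [m-1]\<^sup>-}\<close>, both
  regarded as subsets of \<open>[m-1]\<close>.\<close>

definition pos_part :: "nat \<Rightarrow> int set \<Rightarrow> nat set" where
  "pos_part m J = {i \<in> {1..<m}. int i \<in> J}"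

definition neg_part :: "nat \<Rightarrow> int set \<Rightarrow> nat set" where
  "neg_part m J = {i \<in> {1..<m}. - int i \<in> J}"

definition admissible :: "nat \<Rightarrow> (nat \<Rightarrow> real) \<Rightarrow> int set \<Rightarrow> bool" where
  "admissible m \<alpha> J \<longleftrightarrow>
     J \<subseteq> signed_indices m \<and>
     pos_part m J \<inter> neg_part m J = {} \<and>
     \<bar>\<alpha> m + (\<Sum>i\<in>pos_part m J. \<alpha> i) - (\<Sum>j\<in>neg_part m J. \<alpha> j)\<bar>
       < (\<Sum>k\<in>{1..<m} - (pos_part m J \<union> neg_part m J). \<alpha> k)"

definition Ad :: "nat \<Rightarrow> (nat \<Rightarrow> real) \<Rightarrow> int set set" where
  "Ad m \<alpha> = {J. admissible m \<alpha> J}"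

text \<open>
  \<open>\<real>\<^sup>m\<^sup>-\<^sup>1\<close> is \<open>real ^ 'n\<close>, its coordinates being numbered by a bijection
  \<open>e : {1..<m} \<rightarrow> 'n\<close>: the \<open>i\<close>-th coordinate of \<open>w\<close> is \<open>w $ e i\<close>.
\<close>

definition moment_polytope :: "nat \<Rightarrow> (nat \<Rightarrow> 'n) \<Rightarrow> (nat \<Rightarrow> real) \<Rightarrow> (real ^ 'n) set" where
  "moment_polytope m e \<alpha> =
     {w. (\<forall>i\<in>{1..<m}. w $ e i \<in> {- \<alpha> i .. \<alpha> i}) \<and> (\<Sum>i\<in>{1..<m}. w $ e i) = \<alpha> m}"

text \<open>The faces include the polytope itself but not the empty set: \<open>Ad\<close> has no element for the
  empty face.\<close>

definition nonempty_faces :: "'a::real_vector set \<Rightarrow> 'a set set" where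
  "nonempty_faces P = {F. F face_of P \<and> F \<noteq> {}}"

definition poset_isomorphic ::
    "'a set \<Rightarrow> ('a \<Rightarrow> 'a \<Rightarrow> bool) \<Rightarrow> 'b set \<Rightarrow> ('b \<Rightarrow> 'b \<Rightarrow> bool) \<Rightarrow> bool" where
  "poset_isomorphic A le B le' \<longleftrightarrow>
     (\<exists>f. bij_betw f A B \<and> (\<forall>x\<in>A. \<forall>y\<in>A. le x y \<longleftrightarrow> le' (f x) (f y)))"

end

theory Submission
  imports Defs
begin

text \<open>
  On the polytope each signed index \<open>j\<close> gives a nonnegative affine function \<open>slack j\<close>, vanishing
  on one of the two facets of the box in direction \<open>\<bar>j\<bar>\<close>.  The set \<open>tight x\<close> of slacks vanishing
  at a point \<open>x\<close> is admissible: summing the strict bounds on the free coordinates gives the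
  required inequality, and genericity excludes that there are no free coordinates.  Conversely an
  admissible \<open>J\<close> is the tight set of the point whose free coordinates are proportional to \<open>\<alpha>\<close>.
  So \<open>J \<mapsto> {x. J \<subseteq> tight x}\<close> is an order embedding into the nonempty faces.  It is onto, since a
  face containing \<open>x\<close> contains every \<open>y\<close> with \<open>tight x \<subseteq> tight y\<close> (prolong the segment from \<open>y\<close>
  beyond \<open>x\<close>), and a point of the face with fewest tight slacks has its tight set contained in all
  the others (take midpoints).
\<close>

section \<open>Setting, slack functions and tight sets\<close>

locale generic_moment_polytope =
  fixes m :: nat and \<alpha> :: "nat \<Rightarrow> real" and e :: "nat \<Rightarrow> 'n::finite"
  assumes bij_e: "bij_betw e {1..<m} (UNIV :: 'n set)"
    and length_vector: "length_vector m \<alpha>"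
    and generic: "generic m \<alpha>"
begin

abbreviation P :: "(real ^ 'n) set" where
  "P \<equiv> moment_polytope m e \<alpha>"

text \<open>
  The sign is opposite to the one in the paper's description of the faces: the sum
  \<open>\<alpha>\<^sub>m + \<alpha>\<^bsub>J\<^sub>1\<^esub> - \<alpha>\<^bsub>J\<^sub>2\<^esub>\<close> in the definition of admissibility is what the free coordinates add up to
  when \<open>x\<^sub>j = -\<alpha>\<^sub>j\<close> on \<open>J\<^sub>1\<close> and \<open>x\<^sub>j = \<alpha>\<^sub>j\<close> on \<open>-J\<^sub>2\<close>.
\<close>

definition slack :: "int \<Rightarrow> real ^ 'n \<Rightarrow> real" where
  "slack j x = \<alpha> (nat \<bar>j\<bar>) + of_int (sgn j) * x $ e (nat \<bar>j\<bar>)"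

definition tight :: "real ^ 'n \<Rightarrow> int set" where
  "tight x = {j \<in> signed_indices m. slack j x = 0}"

definition face :: "int set \<Rightarrow> (real ^ 'n) set" where
  "face J = {x \<in> P. J \<subseteq> tight x}"

lemma alpha_pos: "i \<in> {1..<m} \<Longrightarrow> 0 < \<alpha> i"
  using length_vector by (auto simp: length_vector_def)

text \<open>A type is never empty, so \<open>e\<close> needs at least one index.\<close>

lemma m_gt_1: "1 < m"
proof (rule ccontr)
  assume "\<not> 1 < m"
  then have "{1..<m} = {}" by auto
  with bij_e show False by (simp add: bij_betw_def)
qed

lemma finite_signed_indices: "finite (signed_indices m)"
  by (simp add: signed_indices_def)

lemma slack_int [simp]: "i \<in> {1..<m} \<Longrightarrow> slack (int i) x = \<alpha> i + x $ e i"
  and slack_minus_int [simp]: "i \<in> {1..<m} \<Longrightarrow> slack (- int i) x = \<alpha> i - x $ e i"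
  by (auto simp: slack_def)

lemma ball_signed_indices:
  "(\<forall>j\<in>signed_indices m. Q j) \<longleftrightarrow> (\<forall>i\<in>{1..<m}. Q (int i) \<and> Q (- int i))"
  by (auto simp: signed_indices_def)

lemma mem_P_iff:
  "x \<in> P \<longleftrightarrow> (\<forall>j\<in>signed_indices m. 0 \<le> slack j x) \<and> (\<Sum>i\<in>{1..<m}. x $ e i) = \<alpha> m"
  unfolding moment_polytope_def ball_signed_indices by (force simp del: atLeastLessThan_iff)

section \<open>Slacks along lines\<close>

text \<open>Here \<open>u\<close> ranges over all reals, so that points beyond the ends of a segment
  are covered as well.\<close>

lemma slack_affine: "slack j ((1 - u) *\<^sub>R x + u *\<^sub>R y) = (1 - u) * slack j x + u * slack j y"
  by (simp add: slack_def algebra_simps)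

lemma sum_affine:
  fixes x y :: "real ^ 'n"
  assumes "(\<Sum>i\<in>{1..<m}. x $ e i) = c" "(\<Sum>i\<in>{1..<m}. y $ e i) = c"
  shows "(\<Sum>i\<in>{1..<m}. ((1 - u) *\<^sub>R x + u *\<^sub>R y) $ e i) = c"
proof -
  have "(\<Sum>i\<in>{1..<m}. ((1 - u) *\<^sub>R x + u *\<^sub>R y) $ e i)
      = (1 - u) * (\<Sum>i\<in>{1..<m}. x $ e i) + u * (\<Sum>i\<in>{1..<m}. y $ e i)"
    by (simp add: sum.distrib sum_distrib_left)
  with assms show ?thesis by (simp add: algebra_simps)
qed

lemma P_affine:
  assumes "x \<in> P" "y \<in> P" "0 \<le> u" "u \<le> 1"
  shows "(1 - u) *\<^sub>R x + u *\<^sub>R y \<in> P"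
  using assms unfolding mem_P_iff slack_affine by (intro conjI sum_affine) auto

text \<open>A sum of nonnegative slacks with positive weights vanishes only if both slacks
  do.\<close>

lemma tight_affine:
  assumes "x \<in> P" "y \<in> P" "0 < u" "u < 1"
  shows "tight ((1 - u) *\<^sub>R x + u *\<^sub>R y) = tight x \<inter> tight y"
proof -
  have "slack j ((1 - u) *\<^sub>R x + u *\<^sub>R y) = 0 \<longleftrightarrow> slack j x = 0 \<and> slack j y = 0"
    if "j \<in> signed_indices m" for j
  proof -
    have "0 \<le> slack j x" "0 \<le> slack j y" using that assms by (auto simp: mem_P_iff)
    then show ?thesis
      using assms by (simp add: slack_affine add_nonneg_eq_0_iff)
  qed
  then show ?thesis by (auto simp: tight_def)
qed

section \<open>Faces of the polytope\<close>

lemma face_face_of: "face J face_of P"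
  unfolding face_of_def
proof (intro conjI ballI impI)
  show "face J \<subseteq> P" by (auto simp: face_def)
  show "convex (face J)"
    unfolding convex_alt
  proof (intro ballI allI impI)
    fix x y and u :: real
    assume "x \<in> face J" "y \<in> face J" "0 \<le> u \<and> u \<le> 1"
    then show "(1 - u) *\<^sub>R x + u *\<^sub>R y \<in> face J"
      using P_affine by (force simp: face_def tight_def slack_affine)
  qed
next
  fix a b x assume "a \<in> P" "b \<in> P" "x \<in> face J" "x \<in> open_segment a b"
  then obtain u where u: "0 < u" "u < 1" "x = (1 - u) *\<^sub>R a + u *\<^sub>R b"
    by (auto simp: in_segment)
  with \<open>x \<in> face J\<close> have "J \<subseteq> tight a \<inter> tight b"
    using tight_affine [OF \<open>a \<in> P\<close> \<open>b \<in> P\<close>] by (auto simp: face_def)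
  then show "a \<in> face J" "b \<in> face J"
    using \<open>a \<in> P\<close> \<open>b \<in> P\<close> by (auto simp: face_def)
qed

text \<open>A slack vanishing at \<open>x\<close> also vanishes at \<open>y\<close>, hence on the
  whole line. Each of the finitely many others is positive at \<open>x\<close> and stays so for
  small \<open>\<epsilon>\<close>.\<close>

lemma prolong_segment:
  assumes "x \<in> P" "y \<in> P" "tight x \<subseteq> tight y"
  obtains \<epsilon> where "\<epsilon> > 0" "(1 + \<epsilon>) *\<^sub>R x - \<epsilon> *\<^sub>R y \<in> P"
proof -
  have "\<forall>\<^sub>F \<epsilon> in at_right 0. 0 \<le> (1 + \<epsilon>) * slack j x - \<epsilon> * slack j y"
    if j: "j \<in> signed_indices m" for j
  proof (cases "slack j x = 0")
    case True
    with j assms(3) have "slack j y = 0" by (auto simp: tight_def)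
    with True show ?thesis by simp
  next
    case False
    have "((\<lambda>\<epsilon>. (1 + \<epsilon>) * slack j x - \<epsilon> * slack j y)
        \<longlongrightarrow> (1 + 0) * slack j x - 0 * slack j y) (at_right 0)"
      by (intro tendsto_intros)
    moreover have "0 < slack j x" using False assms(1) j by (force simp: mem_P_iff)
    ultimately have "\<forall>\<^sub>F \<epsilon> in at_right 0. 0 < (1 + \<epsilon>) * slack j x - \<epsilon> * slack j y"
      by (intro order_tendstoD) auto
    then show ?thesis by (rule eventually_mono) simp
  qed
  then have "\<forall>\<^sub>F \<epsilon> in at_right 0. \<forall>j\<in>signed_indices m. 0 \<le> (1 + \<epsilon>) * slack j x - \<epsilon> * slack j y"
    using finite_signed_indices by (simp add: eventually_ball_finite)
  then have "\<forall>\<^sub>F \<epsilon> in at_right (0::real). 0 < \<epsilon> \<and>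
      (\<forall>j\<in>signed_indices m. 0 \<le> (1 + \<epsilon>) * slack j x - \<epsilon> * slack j y)"
    using eventually_at_right_less by (rule eventually_conj [rotated])
  then obtain \<epsilon> where \<epsilon>: "0 < \<epsilon>"
      "\<And>j. j \<in> signed_indices m \<Longrightarrow> 0 \<le> (1 + \<epsilon>) * slack j x - \<epsilon> * slack j y"
    using eventually_happens' [OF trivial_limit_at_right_real] by blast
  \<comment> \<open>Parameter \<open>- \<epsilon>\<close> puts the prolonged point in the form of
    the affine lemmas.\<close>
  have "(1 - (- \<epsilon>)) *\<^sub>R x + (- \<epsilon>) *\<^sub>R y \<in> P"
    using assms(1,2) \<epsilon>(2) unfolding mem_P_iff slack_affine
    by (intro conjI sum_affine) auto
  then show thesis using \<epsilon>(1) by (intro that [of \<epsilon>]) auto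
qed

lemma face_tight_subset:
  assumes F: "F face_of P" and x: "x \<in> F"
  shows "face (tight x) \<subseteq> F"
proof
  fix y assume y: "y \<in> face (tight x)"
  have xP: "x \<in> P" using F x face_of_imp_subset by blast
  have yP: "y \<in> P" and "tight x \<subseteq> tight y" using y by (auto simp: face_def)
  then obtain \<epsilon> where \<epsilon>: "\<epsilon> > 0" and zP: "(1 + \<epsilon>) *\<^sub>R x - \<epsilon> *\<^sub>R y \<in> P" (is "?z \<in> P")
    using prolong_segment xP by blast
  show "y \<in> F"
  proof (cases "y = x")
    case False
    \<comment> \<open>In \<open>x = (1 - d) y + d z\<close> with
      \<open>z = (1 + \<epsilon>) x - \<epsilon> y\<close>, the coefficient
      \<open>d * (1 + \<epsilon>)\<close> of \<open>x\<close> has to be 1; the coefficient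
      \<open>1 - d - d * \<epsilon>\<close> of \<open>y\<close> then vanishes.\<close>
    define d where "d = 1 / (1 + \<epsilon>)"
    have d: "0 < d" "d < 1" "d * (1 + \<epsilon>) = 1" "1 - d = d * \<epsilon>"
      using \<epsilon> by (auto simp: d_def field_simps)
    have "x = (1 - d) *\<^sub>R y + d *\<^sub>R ?z"
      by (simp only: scaleR_diff_right scaleR_scaleR d) simp
    moreover have "y \<noteq> ?z"
    proof
      assume "y = ?z"
      then have "(1 + \<epsilon>) *\<^sub>R (x - y) = 0" by (simp add: algebra_simps)
      with False \<epsilon> show False by simp
    qed
    ultimately have "x \<in> open_segment y ?z"
      using d unfolding in_segment by (intro conjI exI [of _ d]) auto
    then show ?thesis using F x yP zP by (blast dest: face_ofD)
  qed (use x in simp)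
qed

lemma face_of_eq_face_tight:
  assumes F: "F face_of P" and "F \<noteq> {}"
  obtains x where "x \<in> P" "F = face (tight x)"
proof -
  obtain x0 where "x0 \<in> F" using \<open>F \<noteq> {}\<close> by blast
  then obtain x where x: "x \<in> F" and min: "\<And>y. y \<in> F \<Longrightarrow> card (tight x) \<le> card (tight y)"
    using ex_has_least_nat [of "\<lambda>x. x \<in> F" x0 "\<lambda>x. card (tight x)"] by blast
  have FP: "F \<subseteq> P" using F face_of_imp_subset by blast
  have "tight x \<subseteq> tight y" if y: "y \<in> F" for y
  proof -
    \<comment> \<open>The midpoint lies in \<open>F\<close> and is tight only where both
      \<open>x\<close> and \<open>y\<close> are, so minimality of \<open>card (tight x)\<close>
      prevents the intersection from being smaller than \<open>tight x\<close>.\<close>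
    define z where "z = (1 - 1/2) *\<^sub>R x + (1/2 :: real) *\<^sub>R y"
    have "z \<in> F"
      unfolding z_def using face_of_imp_convex [OF F] x y by (rule convexD_alt) auto
    moreover have "tight z = tight x \<inter> tight y"
      unfolding z_def using x y FP by (intro tight_affine) auto
    moreover have "finite (tight x)"
      using finite_signed_indices by (simp add: tight_def)
    ultimately have "tight x \<inter> tight y = tight x"
      using min [of z] by (intro card_seteq) auto
    then show ?thesis by blast
  qed
  then have "F \<subseteq> face (tight x)" using FP by (auto simp: face_def)
  with face_tight_subset [OF F x] have "F = face (tight x)" by blast
  with x FP show thesis by (intro that [of x]) auto
qed

section \<open>Tight sets are the admissible sets\<close>

lemma pos_part_tight: "pos_part m (tight x) = {i \<in> {1..<m}. x $ e i = - \<alpha> i}"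
  and neg_part_tight: "neg_part m (tight x) = {i \<in> {1..<m}. x $ e i = \<alpha> i}"
  by (auto simp: pos_part_def neg_part_def tight_def signed_indices_def slack_def)

lemma sum_split:
  fixes f :: "nat \<Rightarrow> real"
  assumes "A \<subseteq> {1..<m}" "B \<subseteq> {1..<m}" "A \<inter> B = {}"
  shows "sum f {1..<m} = sum f A + sum f B + sum f ({1..<m} - (A \<union> B))"
proof -
  have "finite A" "finite B" using assms finite_subset by blast+
  with assms show ?thesis
    using sum.subset_diff [of "A \<union> B" "{1..<m}" f] by (simp add: sum.union_disjoint)
qed

lemma admissible_tight:
  assumes x: "x \<in> P"
  shows "admissible m \<alpha> (tight x)"
proof -
  define A where "A = pos_part m (tight x)"
  define B where "B = neg_part m (tight x)"
  define C where "C = {1..<m} - (A \<union> B)"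
  have A: "A \<subseteq> {1..<m}" "\<And>i. i \<in> A \<Longrightarrow> x $ e i = - \<alpha> i"
    and B: "B \<subseteq> {1..<m}" "\<And>i. i \<in> B \<Longrightarrow> x $ e i = \<alpha> i"
    by (auto simp: A_def B_def pos_part_tight neg_part_tight)
  have AB: "A \<inter> B = {}"
    using alpha_pos by (force simp: A_def B_def pos_part_tight neg_part_tight)
  have C: "\<bar>x $ e i\<bar> < \<alpha> i" if "i \<in> C" for i
  proof -
    have "i \<in> {1..<m}" "x $ e i \<noteq> \<alpha> i" "x $ e i \<noteq> - \<alpha> i"
      using that by (auto simp: C_def A_def B_def pos_part_tight neg_part_tight)
    moreover have "x $ e i \<in> {- \<alpha> i..\<alpha> i}"
      using x \<open>i \<in> {1..<m}\<close> unfolding moment_polytope_def by blast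
    ultimately show ?thesis by auto
  qed
  have sum_x: "(\<Sum>i\<in>{1..<m}. x $ e i) = \<alpha> m" using x by (simp add: mem_P_iff)
  have "(\<Sum>i\<in>{1..<m}. x $ e i) = - sum \<alpha> A + sum \<alpha> B + (\<Sum>i\<in>C. x $ e i)"
    unfolding C_def sum_split [OF A(1) B(1) AB] using A(2) B(2) by (simp add: sum_negf)
  with sum_x have free_sum: "\<alpha> m + sum \<alpha> A - sum \<alpha> B = (\<Sum>i\<in>C. x $ e i)" by simp
  \<comment> \<open>Otherwise every coordinate is \<open>\<alpha> i\<close> or
    \<open>- \<alpha> i\<close>. Moving \<open>\<alpha> m\<close> to the other side of the sum
    condition then gives a vanishing signed sum of all lengths.\<close>
  have "C \<noteq> {}"
  proof
    assume "C = {}"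
    define s :: "nat \<Rightarrow> real" where "s i = (if i = m then -1 else if i \<in> A then -1 else 1)" for i
    have "(\<Sum>i=1..m. s i * \<alpha> i) = (\<Sum>i\<in>{1..<m}. s i * \<alpha> i) + s m * \<alpha> m"
      using m_gt_1 by (simp add: sum.last_plus add.commute)
    also have "(\<Sum>i\<in>{1..<m}. s i * \<alpha> i) = (\<Sum>i\<in>{1..<m}. x $ e i)"
      using \<open>C = {}\<close> A(2) B(2) by (intro sum.cong) (auto simp: s_def C_def)
    finally have "(\<Sum>i=1..m. s i * \<alpha> i) = 0" using sum_x by (simp add: s_def)
    moreover have "\<forall>i\<in>{1..m}. s i \<in> {-1, 1}" by (auto simp: s_def)
    ultimately show False using generic unfolding generic_def by blast
  qed
  moreover have "finite C" by (simp add: C_def)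
  \<comment> \<open>Strictness of the sum rests on \<open>C\<close> being nonempty.\<close>
  ultimately have "(\<Sum>i\<in>C. \<bar>x $ e i\<bar>) < sum \<alpha> C"
    using C by (intro sum_strict_mono) auto
  with free_sum have "\<bar>\<alpha> m + sum \<alpha> A - sum \<alpha> B\<bar> < sum \<alpha> C"
    using sum_abs [of "\<lambda>i. x $ e i" C] by linarith
  with AB show ?thesis
    by (auto simp: admissible_def tight_def A_def B_def C_def)
qed

lemma eq_if_parts_eq:
  assumes "J \<subseteq> signed_indices m" "K \<subseteq> signed_indices m"
    and "pos_part m J = pos_part m K" "neg_part m J = neg_part m K"
  shows "J = K"
proof -
  have "int i \<in> J \<longleftrightarrow> int i \<in> K" "- int i \<in> J \<longleftrightarrow> - int i \<in> K" if "i \<in> {1..<m}" for i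
    using assms(3,4) that unfolding pos_part_def neg_part_def by blast+
  then have "\<forall>j\<in>signed_indices m. j \<in> J \<longleftrightarrow> j \<in> K"
    unfolding ball_signed_indices by blast
  with assms(1,2) show ?thesis by blast
qed

lemma admissible_imp_tight:
  assumes J: "admissible m \<alpha> J"
  obtains x where "x \<in> P" "tight x = J"
proof -
  define A where "A = pos_part m J"
  define B where "B = neg_part m J"
  define C where "C = {1..<m} - (A \<union> B)"
  have A: "A \<subseteq> {1..<m}" and B: "B \<subseteq> {1..<m}"
    by (auto simp: A_def B_def pos_part_def neg_part_def)
  have AB: "A \<inter> B = {}" and less: "\<bar>\<alpha> m + sum \<alpha> A - sum \<alpha> B\<bar> < sum \<alpha> C"
    using J by (auto simp: admissible_def A_def B_def C_def)
  \<comment> \<open>The ratio for which the coordinates add up to \<open>\<alpha> m\<close>.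
    Admissibility makes the denominator positive and \<open>\<bar>t\<bar> < 1\<close>, which keeps
    the free coordinates off both facets.\<close>
  define t where "t = (\<alpha> m + sum \<alpha> A - sum \<alpha> B) / sum \<alpha> C"
  have t: "\<bar>t\<bar> < 1" "t * sum \<alpha> C = \<alpha> m + sum \<alpha> A - sum \<alpha> B"
    using less by (auto simp: t_def field_simps)
  define f where "f i = (if i \<in> A then - \<alpha> i else if i \<in> B then \<alpha> i else t * \<alpha> i)" for i
  define x :: "real ^ 'n" where "x = (\<chi> k. f (inv_into {1..<m} e k))"
  have x_e: "x $ e i = f i" if "i \<in> {1..<m}" for i
    using that bij_e by (simp add: x_def bij_betw_inv_into_left)
  have f: "\<bar>f i\<bar> \<le> \<alpha> i" "f i = - \<alpha> i \<longleftrightarrow> i \<in> A" "f i = \<alpha> i \<longleftrightarrow> i \<in> B"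
    if "i \<in> {1..<m}" for i
  proof -
    have pos: "0 < \<alpha> i" using that by (rule alpha_pos)
    then have "\<bar>t * \<alpha> i\<bar> < \<alpha> i" using t(1) by (simp add: abs_mult)
    then show "\<bar>f i\<bar> \<le> \<alpha> i" "f i = - \<alpha> i \<longleftrightarrow> i \<in> A" "f i = \<alpha> i \<longleftrightarrow> i \<in> B"
      using AB pos unfolding f_def by (auto split: if_splits)
  qed
  have "(\<Sum>i\<in>{1..<m}. x $ e i) = sum f {1..<m}" by (simp add: x_e)
  also have "\<dots> = sum f A + sum f B + sum f C"
    unfolding C_def by (rule sum_split [OF A B AB])
  also have "sum f A = - sum \<alpha> A" by (simp add: f_def sum_negf)
  also have "sum f B = sum \<alpha> B" using AB by (intro sum.cong) (auto simp: f_def)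
  also have "sum f C = t * sum \<alpha> C"
    unfolding sum_distrib_left by (intro sum.cong) (auto simp: f_def C_def)
  finally have "(\<Sum>i\<in>{1..<m}. x $ e i) = \<alpha> m" using t(2) by simp
  moreover have "x $ e i \<in> {- \<alpha> i..\<alpha> i}" if "i \<in> {1..<m}" for i
    using f(1) [OF that] x_e [OF that] by (simp add: abs_le_iff)
  ultimately have "x \<in> P" by (simp add: moment_polytope_def)
  moreover have "tight x = J"
  proof (rule eq_if_parts_eq)
    show "pos_part m (tight x) = pos_part m J"
      using A f(2) x_e unfolding pos_part_tight A_def [symmetric] by auto
    show "neg_part m (tight x) = neg_part m J"
      using B f(3) x_e unfolding neg_part_tight B_def [symmetric] by auto
  qed (use J in \<open>auto simp: admissible_def tight_def\<close>)
  ultimately show thesis by (rule that)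
qed

section \<open>The isomorphism\<close>

text \<open>A point with tight set exactly \<open>J\<close> lies in \<open>face J\<close>, hence in
  \<open>face S\<close>, and so detects that \<open>S \<subseteq> J\<close>.\<close>

lemma face_subset_iff:
  assumes "J \<in> Ad m \<alpha>"
  shows "face J \<subseteq> face S \<longleftrightarrow> S \<subseteq> J"
proof
  obtain x where "x \<in> P" "tight x = J"
    using assms admissible_imp_tight by (auto simp: Ad_def)
  moreover assume "face J \<subseteq> face S"
  ultimately show "S \<subseteq> J" by (auto simp: face_def)
qed (auto simp: face_def)

lemma bij_betw_face: "bij_betw face (Ad m \<alpha>) (nonempty_faces P)"
  unfolding bij_betw_def
proof (intro conjI equalityI subsetI)
  \<comment> \<open>Equal faces contain each other, so the index sets do too.\<close>
  show "inj_on face (Ad m \<alpha>)"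
    using face_subset_iff by (intro inj_onI) blast
  fix F assume "F \<in> face ` Ad m \<alpha>"
  then obtain J where J: "admissible m \<alpha> J" "F = face J" by (auto simp: Ad_def)
  obtain x where "x \<in> P" "tight x = J" using admissible_imp_tight [OF J(1)] .
  with J show "F \<in> nonempty_faces P"
    using face_face_of by (auto simp: nonempty_faces_def face_def)
next
  fix F assume "F \<in> nonempty_faces P"
  then obtain x where "x \<in> P" "F = face (tight x)"
    using face_of_eq_face_tight by (auto simp: nonempty_faces_def)
  then show "F \<in> face ` Ad m \<alpha>"
    using admissible_tight by (auto simp: Ad_def)
qed

end

theorem theorem4p7:
  fixes m :: nat and \<alpha> :: "nat \<Rightarrow> real" and e :: "nat \<Rightarrow> 'n::finite"
  assumes "bij_betw e {1..<m} (UNIV :: 'n set)"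
    and "length_vector m \<alpha>"
    and "generic m \<alpha>"
    and "\<alpha> m < (\<Sum>i\<in>{1..<m}. \<alpha> i)"
  shows "poset_isomorphic
           (Ad m \<alpha>) (\<lambda>J S. S \<subseteq> J)
           (nonempty_faces (moment_polytope m e \<alpha>)) (\<lambda>F G. F \<subseteq> G)"
proof -
  interpret generic_moment_polytope m \<alpha> e
    using assms by unfold_locales
  show ?thesis
    unfolding poset_isomorphic_def using bij_betw_face face_subset_iff by blast
qed

end
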